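(* Let $\mathbf{A}\in\mathbb{R}^{m\times n}$ and $\mathbf{b}\in\mathbb{R}^{m}$ be such that the linear system $\mathbf{A}\mathbf{x}=\mathbf{b}$ is consistent, let $1\le k_{\max}\le m$ be an integer and let $\mathbf{x}_0\in\mathbb{R}^n$ be the initial vector. Let $\{\mathbf{x}_t\}_{t=0}^{\infty}$ be the iteration sequence generated by the semi-randomized block Kaczmarz method for a single right-hand side (described in the context), with index sets $J_t$. Then $\{\mathbf{x}_t\}_{t=0}^\infty$ converges to the least-squares solution $\mathbf{x}_\star=\mathbf{A}^{\dagger}\mathbf{b}$, with $$\|\mathbf{x}_{t+1}-\mathbf{x}_{\star}\|_{2}^{2}\leq\left(1-\varsigma_{t}\right)\|\mathbf{x}_{t}-\mathbf{x}_{\star}\|_{2}^{2},$$ where $$\varsigma_{t}=\frac{\|\mathbf{A}_{J_{t}}\|_{F}^{2}}{\|\mathbf{A}\|_{F}^{2}+(\lambda_{t}-1)\|\mathbf{A}_{J_{t}}\|_{F}^{2}}\cdot\frac{\sigma_{\min}^{2}(\mathbf{A})}{\sigma_{\max}^{2}(\mathbf{A}_{J_{t}})}, \qquad \lambda_{t}=\max_{j\in J_{t}}\left\{\frac{|\mathbf{b}_{(j)}-\mathbf{A}_{(j)}\mathbf{x}_{t}|^{2}/\|\mathbf{A}_{(j)}\|_{2}^{2}}{\min_{i\in J_{t}}\left\{|\mathbf{b}_{(i)}-\mathbf{A}_{(i)}\mathbf{x}_{t}|^{2}/\|\mathbf{A}_{(i)}\|_{2}^{2}\right\}}\right\}\geq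 1.$$ Here $\sigma_{\min}(\mathbf{A})$ denotes the smallest nonzero singular value of $\mathbf{A}$ and $\sigma_{\max}(\mathbf{A}_{J_t})$ the largest singular value of $\mathbf{A}_{J_t}$.
   Context: Notation: $\mathbf{A}_{(i)}$ is the $i$-th row of $\mathbf{A}$ (all rows nonzero), $\mathbf{b}_{(i)}$ is the $i$-th entry of $\mathbf{b}$, $\mathbf{A}^\dagger$ is the Moore-Penrose inverse, $\|\cdot\|_F$ the Frobenius norm. For an index set $J\subseteq\{1,\dots,m\}$, $\mathbf{A}_{J}$ and $\mathbf{b}_J$ are the row submatrix of $\mathbf{A}$ and the subvector of $\mathbf{b}$ indexed by $J$. The method: given $\mathbf{x}_0$, for $t=0,1,2,\dots$: (1) compute $\beta_{(j)}=\dfrac{|\mathbf{b}_{(j)}-\mathbf{A}_{(j)}\mathbf{x}_{t}|}{\|\mathbf{A}_{(j)}\|_{2}}$ for all $j\in\{1,\dots,m\}$; (2) let $J_t\subseteq\{1,\dots,m\}$ be the set of indices of the $k_{\max}$ largest values among the $\beta_{(j)}$ (so $|J_t|=k_{\max}$ and $\beta_{(j)}\ge\beta_{(i)}$ for all $j\in J_t$, $i\notin J_t$); (3) set $\mathbf{x}_{t+1}=\mathbf{x}_{t}+\mathbf{A}_{J_{t}}^{\dagger}(\mathbf{b}_{J_{t}}-\mathbf{A}_{J_{t}}\mathbf{x}_{t})$. The sequence is the one obtained without early stopping. The inequality is for those $t$ at which $\lambda_t$ is defined, i.e. the minimum in its denominator is nonzero.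
   Formalization: The initial vector x_0 is additionally required to lie in the row space of A (the range of A^T); without this the claim fails, e.g. A=[1 0], b=0, x_0=(1,1), and convergence to A^†b forces it. *)

theory Defs
  imports "HOL-Analysis.Analysis"
begin

definition penrose :: "real^'n^'m \<Rightarrow> real^'m^'n \<Rightarrow> bool" where
  "penrose A X \<longleftrightarrow>
     A ** X ** A = A \<and> X ** A ** X = X \<and>
     transpose (A ** X) = A ** X \<and> transpose (X ** A) = X ** A"

text \<open>The Moore-Penrose inverse is the unique solution of the four Penrose equations.\<close>

definition pinv :: "real^'n^'m \<Rightarrow> real^'m^'n" where
  "pinv A = (THE X. penrose A X)"

definition frobenius_norm :: "real^'n^'m \<Rightarrow> real" where
  "frobenius_norm A = sqrt (\<Sum>i\<in>UNIV. \<Sum>j\<in>UNIV. (A $ i $ j)\<^sup>2)"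

lemma frobenius_norm_eq_norm: "frobenius_norm A = norm A"
  by (simp add: frobenius_norm_def norm_vec_def L2_set_def sum_nonneg)

text \<open>
  These are the square roots of the eigenvalues of \<open>A\<^sup>T A\<close>. If \<open>A\<close> has more columns than rows,
  this set contains 0 even when the list of min(m, n) singular values does not; for a nonzero
  matrix neither the largest nor the smallest nonzero singular value is affected.
\<close>

definition singular_values :: "real^'n^'m \<Rightarrow> real set" where
  "singular_values A =
     {s. 0 \<le> s \<and> (\<exists>v. v \<noteq> 0 \<and> (transpose A ** A) *v v = s\<^sup>2 *\<^sub>R v)}"

definition sigma_max :: "real^'n^'m \<Rightarrow> real" where
  "sigma_max A = Max (singular_values A)"

definition sigma_min :: "real^'n^'m \<Rightarrow> real" where
  "sigma_min A = Min (singular_values A - {0})"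

text \<open>
  The row submatrix with index set \<open>J\<close> has its rows indexed by a type \<open>'k\<close> with \<open>card J\<close>
  elements, through an enumeration \<open>e\<close> of \<open>J\<close>, i.e. a bijection from \<open>UNIV :: 'k set\<close> onto \<open>J\<close>.
\<close>

definition row_submatrix :: "('k::finite \<Rightarrow> 'm) \<Rightarrow> real^'n^'m \<Rightarrow> real^'n^'k" where
  "row_submatrix e A = (\<chi> p. row (e p) A)"

definition subvector :: "('k::finite \<Rightarrow> 'm) \<Rightarrow> real^'m \<Rightarrow> real^'k" where
  "subvector e b = (\<chi> p. b $ e p)"

definition beta :: "real^'n^'m \<Rightarrow> real^'m \<Rightarrow> real^'n \<Rightarrow> 'm \<Rightarrow> real" where
  "beta A b x j = \<bar>b $ j - row j A \<bullet> x\<bar> / norm (row j A)"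

text \<open>Ties may be broken in any way, so \<open>J\<close> need not be determined by \<open>k\<close> and \<open>f\<close>.\<close>

definition indices_of_largest :: "nat \<Rightarrow> ('m \<Rightarrow> real) \<Rightarrow> 'm set \<Rightarrow> bool" where
  "indices_of_largest k f J \<longleftrightarrow> card J = k \<and> (\<forall>j\<in>J. \<forall>i. i \<notin> J \<longrightarrow> f j \<ge> f i)"

text \<open>
  A run of the method without early stopping: \<open>J t\<close> is the index set chosen in step \<open>t\<close>,
  and \<open>e t\<close> is an enumeration of it.
\<close>

definition block_kaczmarz_run ::
  "real^'n^'m \<Rightarrow> real^'m \<Rightarrow> nat \<Rightarrow>
   (nat \<Rightarrow> 'm set) \<Rightarrow> (nat \<Rightarrow> 'k::finite \<Rightarrow> 'm) \<Rightarrow> (nat \<Rightarrow> real^'n) \<Rightarrow> bool" where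
  "block_kaczmarz_run A b kmax J e x \<longleftrightarrow>
     (\<forall>t. indices_of_largest kmax (beta A b (x t)) (J t) \<and>
          bij_betw (e t) UNIV (J t) \<and>
          x (Suc t) =
            x t + pinv (row_submatrix (e t) A) *v
                    (subvector (e t) b - row_submatrix (e t) A *v x t))"

definition lambda_min :: "real^'n^'m \<Rightarrow> real^'m \<Rightarrow> 'm set \<Rightarrow> real^'n \<Rightarrow> real" where
  "lambda_min A b J x =
     Min ((\<lambda>i. \<bar>b $ i - row i A \<bullet> x\<bar>\<^sup>2 / (norm (row i A))\<^sup>2) ` J)"

definition lambda :: "real^'n^'m \<Rightarrow> real^'m \<Rightarrow> 'm set \<Rightarrow> real^'n \<Rightarrow> real" where
  "lambda A b J x =
     Max ((\<lambda>j. (\<bar>b $ j - row j A \<bullet> x\<bar>\<^sup>2 / (norm (row j A))\<^sup>2) / lambda_min A b J x) ` J)"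

definition varsigma ::
  "real^'n^'m \<Rightarrow> real^'m \<Rightarrow> 'm set \<Rightarrow> ('k::finite \<Rightarrow> 'm) \<Rightarrow> real^'n \<Rightarrow> real" where
  "varsigma A b J e x =
     (let AJ = row_submatrix e A in
        (frobenius_norm AJ)\<^sup>2 /
          ((frobenius_norm A)\<^sup>2 + (lambda A b J x - 1) * (frobenius_norm AJ)\<^sup>2)
        * ((sigma_min A)\<^sup>2 / (sigma_max AJ)\<^sup>2))"

end

theory Submission
  imports Defs
begin

text \<open>
  With \<open>B = A\<^sub>J\<close>, the matrix \<open>P = B\<^sup>\<dagger> B\<close> is an orthogonal projection and the error
  \<open>d\<close> is updated to \<open>d - P d\<close>, so its squared norm drops by
  \<open>\<parallel>P d\<parallel>\<^sup>2 \<ge> \<parallel>B d\<parallel>\<^sup>2 / \<sigma>\<^sub>m\<^sub>a\<^sub>x\<^sup>2(B)\<close>. The greedy choice of \<open>J\<close> makes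
  \<open>\<parallel>B d\<parallel>\<^sup>2\<close> a definite fraction of \<open>\<parallel>A d\<parallel>\<^sup>2\<close>, which is at least
  \<open>\<sigma>\<^sub>m\<^sub>i\<^sub>n\<^sup>2(A) \<parallel>d\<parallel>\<^sup>2\<close> because the error stays in the row space of \<open>A\<close>.
  The factor \<open>\<varsigma>\<^sub>t\<close> is not bounded away from 0 in an obvious way, so convergence is obtained
  separately: \<open>P\<close> fixes the row of \<open>J\<close> with the largest \<open>\<beta>\<close>, whence
  \<open>\<parallel>P d\<parallel>\<^sup>2 \<ge> max \<beta>\<^sup>2 \<ge> \<parallel>A d\<parallel>\<^sup>2 / \<parallel>A\<parallel>\<^sub>F\<^sup>2\<close>, a rate independent of \<open>t\<close>.
\<close>

section \<open>The Moore-Penrose inverse\<close>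

text \<open>As a simp rule it turns \<open>transpose A *v y\<close> into \<open>y v* A\<close>,
  while the normal equations below keep products by \<open>transpose A\<close>.\<close>

declare transpose_matrix_vector [simp del]

section \<open>Row space, kernel and normal equations\<close>

lemma transpose_mult_in_span_rows:
  fixes A :: "real^'n^'m"
  shows "transpose A *v y \<in> span (rows A)"
  using matrix_vector_mult_in_columnspace[of "transpose A" y] by simp

lemma inner_transpose_mult:
  fixes A :: "real^'n^'m"
  shows "(transpose A *v y) \<bullet> x = y \<bullet> (A *v x)"
  by (simp add: dot_lmul_matrix transpose_matrix_vector)

lemma normal_equation_imp_eq:
  fixes A :: "real^'n^'m"
  assumes "transpose A *v (A *v x) = 0"
  shows "A *v x = 0"
  using inner_transpose_mult[of A "A *v x" x] assms by simp

lemma span_rows_eqI: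
  fixes A :: "real^'n^'m"
  assumes "A *v x = A *v y" "x \<in> span (rows A)" "y \<in> span (rows A)"
  shows "x = y"
  using assms matrix_vector_mul_injective_on_rowspace by blast

text \<open>The row space is the orthogonal complement of the kernel, so projecting \<open>x\<close>
  onto it removes only a kernel component.\<close>

lemma rowspace_decomp:
  fixes A :: "real^'n^'m"
  obtains v where "v \<in> span (rows A)" "A *v v = A *v x"
proof -
  obtain v z where v: "v \<in> span (rows A)" and z: "\<And>w. w \<in> span (rows A) \<Longrightarrow> orthogonal z w"
    and x: "x = v + z"
    using orthogonal_subspace_decomp_exists[of "rows A" x] by metis
  have "(A *v z) $ i = 0" for i
  proof -
    have "row i A \<in> span (rows A)" by (auto intro: span_base simp: rows_def)
    then show ?thesis
      using z[of "row i A"]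
      by (simp add: matrix_vector_mul_component orthogonal_def row_def inner_commute)
  qed
  then have "A *v z = 0" by (simp add: vec_eq_iff)
  then have "A *v v = A *v x" by (simp add: x matrix_vector_right_distrib)
  with v show ?thesis by (rule that)
qed

text \<open>The solution is the least-squares solution of minimal norm. Existence: project
  \<open>y\<close> onto the range of \<open>A\<close> and move the preimage into the row space.
  Uniqueness: \<open>A\<close> is injective on the row space.\<close>

lemma normal_equation_solvable:
  fixes A :: "real^'n^'m"
  shows "\<exists>!x. x \<in> span (rows A) \<and> transpose A *v (A *v x) = transpose A *v y"
proof (rule ex_ex1I)
  have "span (range ((*v) A)) = range ((*v) A)"
    by (simp add: linear_subspace_image)
  then obtain x' z where z: "\<And>w. orthogonal z (A *v w)" and y: "y = A *v x' + z"
    using orthogonal_subspace_decomp_exists[of "range ((*v) A)" y] by (metis image_iff rangeI)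
  have "(transpose A *v z) \<bullet> (transpose A *v z) = 0"
    unfolding inner_transpose_mult
    using z by (simp add: orthogonal_def)
  then have "transpose A *v z = 0" by simp
  then have "transpose A *v y = transpose A *v (A *v x')"
    by (simp add: y matrix_vector_right_distrib)
  moreover obtain v where "v \<in> span (rows A)" "A *v v = A *v x'"
    by (rule rowspace_decomp)
  ultimately show "\<exists>x. x \<in> span (rows A) \<and> transpose A *v (A *v x) = transpose A *v y"
    by metis
next
  fix x x'
  assume "x \<in> span (rows A) \<and> transpose A *v (A *v x) = transpose A *v y"
    and "x' \<in> span (rows A) \<and> transpose A *v (A *v x') = transpose A *v y"
  then show "x = x'"
    using normal_equation_imp_eq[of A "x - x'"] span_rows_eqI[of A x x']
    by (simp add: matrix_vector_mult_diff_distrib)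
qed

lemma symmetric_matrixI:
  fixes M :: "real^'n^'n"
  assumes "\<And>x y. (M *v x) \<bullet> y = x \<bullet> (M *v y)"
  shows "transpose M = M"
proof -
  have "(transpose M *v x) \<bullet> y = (M *v x) \<bullet> y" for x y
    using assms by (simp add: inner_transpose_mult)
  then show ?thesis
    unfolding matrix_eq using vector_eq_rdot by blast
qed

text \<open>The map \<open>g\<close> from \<open>y\<close> to the row-space solution of the normal
  equation is linear by uniqueness, and its matrix is the inverse sought.\<close>

lemma penrose_exists:
  fixes A :: "real^'n^'m"
  shows "\<exists>X. penrose A X"
proof -
  define g where "g y = (THE x. x \<in> span (rows A) \<and> transpose A *v (A *v x) = transpose A *v y)" for y
  have g: "g y \<in> span (rows A)" "transpose A *v (A *v g y) = transpose A *v y" for y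
    using theI'[OF normal_equation_solvable[of A y]] by (simp_all add: g_def)
  have gI: "g y = x" if "x \<in> span (rows A)" "transpose A *v (A *v x) = transpose A *v y" for x y
    using normal_equation_solvable[of A y] g[of y] that by blast
  have "linear g"
  proof (rule linearI)
    show "g (x + y) = g x + g y" for x y
      by (rule gI) (simp_all add: g span_add matrix_vector_right_distrib)
    show "g (c *\<^sub>R x) = c *\<^sub>R g x" for c x
      by (rule gI) (simp_all add: g span_scale matrix_vector_mult_scaleR)
  qed
  define X where "X = matrix g"
  have X: "X *v y = g y" for y
    using \<open>linear g\<close> by (simp add: X_def matrix_works)
  have AXA: "A *v g (A *v y) = A *v y" for y
    using normal_equation_imp_eq[of A "g (A *v y) - y"] g(2)[of "A *v y"]
    by (simp add: matrix_vector_mult_diff_distrib)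
  have XAX: "g (A *v g y) = g y" for y
    by (rule gI) (simp_all add: g)
  \<comment> \<open>The right-hand side is symmetric in \<open>x\<close> and \<open>y\<close>, which
    makes the projection \<open>A ** X\<close> onto the range self-adjoint; \<open>XA_sym\<close>
    does the same for the projection onto the row space.\<close>
  have AX_sym: "(A *v g x) \<bullet> y = (A *v g x) \<bullet> (A *v g y)" for x y
    using g(2)[of y] by (metis inner_transpose_mult inner_commute)
  have XA_sym: "g (A *v x) \<bullet> y = g (A *v x) \<bullet> g (A *v y)" for x y
  proof -
    have "A *v (y - g (A *v y)) = 0" by (simp add: matrix_vector_mult_diff_distrib AXA)
    then have "(y - g (A *v y)) \<bullet> g (A *v x) = 0"
      using orthogonal_nullspace_rowspace g(1) unfolding orthogonal_def by blast
    then show ?thesis by (simp add: inner_diff inner_commute)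
  qed
  have "penrose A X"
    unfolding penrose_def
  proof (intro conjI)
    show "A ** X ** A = A" "X ** A ** X = X"
      by (simp_all add: matrix_eq X AXA XAX flip: matrix_vector_mul_assoc)
    show "transpose (A ** X) = A ** X"
      by (rule symmetric_matrixI) (metis X AX_sym inner_commute matrix_vector_mul_assoc)
    show "transpose (X ** A) = X ** A"
      by (rule symmetric_matrixI) (metis X XA_sym inner_commute matrix_vector_mul_assoc)
  qed
  then show ?thesis ..
qed

text \<open>Both \<open>A ** X\<close> and \<open>A ** Y\<close> are the orthogonal projection onto
  the range of \<open>A\<close>, and \<open>X ** A\<close> and \<open>Y ** A\<close> the one onto
  its row space. Hence X = XAX = XAY = YAY = Y.\<close>

lemma penrose_unique:
  fixes A :: "real^'n^'m"
  assumes X: "penrose A X" and Y: "penrose A Y"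
  shows "X = Y"
proof -
  have "A ** X = transpose (A ** X)" using X by (simp add: penrose_def)
  also have "\<dots> = transpose (A ** Y ** (A ** X))"
    using Y by (simp add: penrose_def matrix_mul_assoc)
  also have "\<dots> = A ** X ** (A ** Y)"
    using X Y by (simp add: penrose_def matrix_transpose_mul)
  also have "\<dots> = A ** Y"
    using X by (simp add: penrose_def matrix_mul_assoc)
  finally have AX: "A ** X = A ** Y" .
  have "X ** A = transpose (X ** A)" using X by (simp add: penrose_def)
  also have "\<dots> = transpose (X ** A ** (Y ** A))"
    using Y by (metis penrose_def matrix_mul_assoc)
  also have "\<dots> = Y ** A ** (X ** A)"
    using X Y by (simp add: penrose_def matrix_transpose_mul)
  also have "\<dots> = Y ** A"
    using X by (metis penrose_def matrix_mul_assoc)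
  finally have XA: "X ** A = Y ** A" .
  have "X = X ** (A ** X)" using X by (simp add: penrose_def matrix_mul_assoc)
  also have "\<dots> = Y ** (A ** Y)" by (simp add: AX XA matrix_mul_assoc)
  also have "\<dots> = Y" using Y by (simp add: penrose_def matrix_mul_assoc)
  finally show ?thesis .
qed

lemma penrose_pinv: "penrose A (pinv A)"
  unfolding pinv_def using penrose_exists penrose_unique by (metis theI)

lemma mult_pinv_mult: "A *v (pinv A *v (A *v x)) = A *v x"
  using penrose_pinv[of A] by (simp add: penrose_def matrix_vector_mul_assoc matrix_mul_assoc)

text \<open>With X the inverse, X = (XA)X, and symmetry of XA puts the transpose of \<open>A\<close>
  in front.\<close>

lemma pinv_in_span_rows: "pinv A *v y \<in> span (rows A)"
proof -
  have "pinv A *v y = transpose A *v (transpose (pinv A) *v (pinv A *v y))"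
    using penrose_pinv[of A]
    by (metis penrose_def matrix_transpose_mul matrix_vector_mul_assoc)
  then show ?thesis by (metis transpose_mult_in_span_rows)
qed

text \<open>Pythagoras: the projected part lies in the row space and the remainder in the
  kernel.\<close>

lemma norm_diff_pinv_projection:
  fixes A :: "real^'n^'m"
  shows "(norm (d - pinv A *v (A *v d)))\<^sup>2 = (norm d)\<^sup>2 - (norm (pinv A *v (A *v d)))\<^sup>2"
proof -
  let ?p = "pinv A *v (A *v d)"
  have "A *v (d - ?p) = 0"
    by (simp add: matrix_vector_mult_diff_distrib mult_pinv_mult)
  then have "(d - ?p) \<bullet> ?p = 0"
    using orthogonal_nullspace_rowspace pinv_in_span_rows unfolding orthogonal_def by blast
  then show ?thesis
    by (simp add: power2_norm_eq_inner inner_diff inner_commute)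
qed

section \<open>Extremal singular values\<close>

text \<open>If \<open>g v\<close> were nonzero, a small move from \<open>v\<close> in the direction
  of \<open>- g v\<close> would make the form negative.\<close>

lemma psd_form_zero_imp_zero:
  fixes g :: "'a::euclidean_space \<Rightarrow> 'a"
  assumes "linear g" and self_adjoint: "\<And>x y. g x \<bullet> y = x \<bullet> g y"
    and S: "subspace S" "\<And>x. x \<in> S \<Longrightarrow> g x \<in> S"
    and psd: "\<And>x. x \<in> S \<Longrightarrow> 0 \<le> x \<bullet> g x"
    and v: "v \<in> S" "v \<bullet> g v = 0"
  shows "g v = 0"
proof (rule ccontr)
  assume "g v \<noteq> 0"
  define a where "a = g v \<bullet> g v"
  define c where "c = g v \<bullet> g (g v)"
  have "a > 0" using \<open>g v \<noteq> 0\<close> by (simp add: a_def)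
  have "c \<ge> 0" using psd S(2) v(1) by (simp add: c_def)
  \<comment> \<open>The form at \<open>v - t *\<^sub>R g v\<close> is
    \<open>t * (t * c - 2 * a)\<close>, so \<open>t * c\<close> must stay below
    \<open>2 * a\<close>; the summand 1 covers \<open>c = 0\<close>.\<close>
  define t where "t = a / (c + 1)"
  have "t > 0" using \<open>a > 0\<close> \<open>c \<ge> 0\<close> by (simp add: t_def)
  have "v - t *\<^sub>R g v \<in> S" using S v by (simp add: subspace_diff subspace_scale)
  then have "0 \<le> (v - t *\<^sub>R g v) \<bullet> g (v - t *\<^sub>R g v)" by (rule psd)
  also have "\<dots> = t * (t * c - 2 * a)"
    using v(2) self_adjoint[of v "g v"]
    by (simp add: linear_diff[OF \<open>linear g\<close>] linear_scale[OF \<open>linear g\<close>] inner_diff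
        a_def c_def algebra_simps)
  finally have "2 * a \<le> t * c" using \<open>t > 0\<close> by (simp add: zero_le_mult_iff)
  moreover have "t * c \<le> a"
    using \<open>a > 0\<close> \<open>c \<ge> 0\<close> by (simp add: t_def field_simps)
  ultimately show False using \<open>a > 0\<close> by simp
qed

text \<open>A minimiser \<open>v\<close> of the Rayleigh quotient exists by compactness. Subtracting
  \<mu> times the identity leaves a form that is nonnegative on \<open>S\<close> and vanishes at
  \<open>v\<close>, so \<open>v\<close> is an eigenvector.\<close>

lemma self_adjoint_least_eigenvalue:
  fixes f :: "'a::euclidean_space \<Rightarrow> 'a"
  assumes "linear f" and self_adjoint: "\<And>x y. f x \<bullet> y = x \<bullet> f y"
    and S: "subspace S" "\<And>x. x \<in> S \<Longrightarrow> f x \<in> S" "S \<noteq> {0}"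
  obtains v \<mu> where "v \<in> S" "v \<noteq> 0" "f v = \<mu> *\<^sub>R v"
    "\<And>x. x \<in> S \<Longrightarrow> \<mu> * (norm x)\<^sup>2 \<le> x \<bullet> f x"
proof -
  have "0 \<in> S" using S(1) by (rule subspace_0)
  then obtain w where w: "w \<in> S" "w \<noteq> 0" using S(3) by blast
  have "w /\<^sub>R norm w \<in> S \<inter> sphere 0 1" using w S(1) by (simp add: subspace_scale)
  moreover have "compact (S \<inter> sphere 0 1)"
    using S(1) closed_Int_compact closed_subspace compact_sphere by blast
  moreover have "continuous_on (S \<inter> sphere 0 1) (\<lambda>x. x \<bullet> f x)"
    using \<open>linear f\<close> by (intro continuous_intros linear_continuous_on) (simp add: linear_conv_bounded_linear)
  ultimately obtain v where v: "v \<in> S" "norm v = 1"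
    and min: "\<And>x. x \<in> S \<Longrightarrow> norm x = 1 \<Longrightarrow> v \<bullet> f v \<le> x \<bullet> f x"
    using continuous_attains_inf[of "S \<inter> sphere 0 1" "\<lambda>x. x \<bullet> f x"]
    by (force simp: dist_norm)
  define \<mu> where "\<mu> = v \<bullet> f v"
  have bound: "\<mu> * (norm x)\<^sup>2 \<le> x \<bullet> f x" if "x \<in> S" for x
  proof (cases "x = 0")
    case False
    have "\<mu> \<le> (x /\<^sub>R norm x) \<bullet> f (x /\<^sub>R norm x)"
      unfolding \<mu>_def using that S(1) False by (intro min) (simp_all add: subspace_scale)
    also have "\<dots> = (x \<bullet> f x) / (norm x)\<^sup>2"
      by (simp add: linear_scale[OF \<open>linear f\<close>] field_simps power2_eq_square)
    finally show ?thesis using False by (simp add: field_simps)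
  qed (simp add: linear_0[OF \<open>linear f\<close>])
  have "f v - \<mu> *\<^sub>R v = 0"
  proof (rule psd_form_zero_imp_zero[where g = "\<lambda>x. f x - \<mu> *\<^sub>R x" and S = S])
    show "linear (\<lambda>x. f x - \<mu> *\<^sub>R x)"
      using \<open>linear f\<close> by (intro linear_compose_sub linear_scale_self)
    show "0 \<le> x \<bullet> (f x - \<mu> *\<^sub>R x)" if "x \<in> S" for x
      using bound[OF that] by (simp add: inner_diff power2_norm_eq_inner)
    show "v \<bullet> (f v - \<mu> *\<^sub>R v) = 0"
      using v(2) by (simp add: inner_diff \<mu>_def flip: power2_norm_eq_inner)
  qed (use S v self_adjoint in \<open>auto simp: inner_diff subspace_diff subspace_scale\<close>)
  then show ?thesis using v bound by (intro that[of v \<mu>]) auto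
qed

section \<open>The Gram matrix of A and its eigenvalues\<close>

lemma gram_self_adjoint:
  fixes A :: "real^'n^'m"
  shows "((transpose A ** A) *v x) \<bullet> y = x \<bullet> ((transpose A ** A) *v y)"
  by (metis inner_commute inner_transpose_mult matrix_vector_mul_assoc)

lemma inner_gram:
  fixes A :: "real^'n^'m"
  shows "x \<bullet> ((transpose A ** A) *v x) = (norm (A *v x))\<^sup>2"
  by (metis inner_commute inner_transpose_mult matrix_vector_mul_assoc power2_norm_eq_inner)

text \<open>Eigenvectors of the Gram matrix for distinct eigenvalues are orthogonal, hence
  independent. Finiteness is what gives \<open>Max\<close> and \<open>Min\<close> over singular
  values their meaning.\<close>

lemma finite_singular_values:
  fixes A :: "real^'n^'m"
  shows "finite (singular_values A)"
proof -
  have "\<forall>s\<in>singular_values A. \<exists>v. v \<noteq> 0 \<and> (transpose A ** A) *v v = s\<^sup>2 *\<^sub>R v"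
    by (auto simp: singular_values_def)
  then obtain v where
    v: "\<And>s. s \<in> singular_values A \<Longrightarrow> v s \<noteq> 0 \<and> (transpose A ** A) *v v s = s\<^sup>2 *\<^sub>R v s"
    by metis
  have orth: "v s \<bullet> v s' = 0"
    if "s \<in> singular_values A" "s' \<in> singular_values A" "s \<noteq> s'" for s s'
  proof -
    have "s\<^sup>2 * (v s \<bullet> v s') = s'\<^sup>2 * (v s \<bullet> v s')"
      using gram_self_adjoint[of A "v s" "v s'"] v[OF that(1)] v[OF that(2)] by simp
    moreover have "s\<^sup>2 \<noteq> s'\<^sup>2"
      using that by (auto simp: singular_values_def power2_eq_iff_nonneg)
    ultimately show ?thesis by simp
  qed
  have "inj_on v (singular_values A)"
    by (rule inj_onI) (metis inner_eq_zero_iff orth v)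
  moreover have "independent (v ` singular_values A)"
    using orth v by (intro pairwise_orthogonal_independent) (auto simp: pairwise_def orthogonal_def)
  ultimately show ?thesis
    using finiteI_independent finite_imageD by blast
qed

lemma norm_mult_le_sigma_max:
  fixes A :: "real^'n^'m"
  shows "norm (A *v x) \<le> sigma_max A * norm x"
proof -
  \<comment> \<open>The sign turns the largest eigenvalue of the Gram matrix into a least
    one.\<close>
  let ?f = "\<lambda>x. - ((transpose A ** A) *v x)"
  obtain v \<mu> where v: "v \<noteq> 0" "?f v = \<mu> *\<^sub>R v"
    and bound: "\<And>x. \<mu> * (norm x)\<^sup>2 \<le> x \<bullet> ?f x"
  proof (rule self_adjoint_least_eigenvalue[of ?f UNIV])
    show "linear ?f" by (intro linear_compose_neg matrix_vector_mul_linear)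
    show "UNIV \<noteq> {0::real^'n}" using UNIV_not_singleton by blast
  qed (auto simp: gram_self_adjoint)
  have "v \<bullet> ?f v = \<mu> * (norm v)\<^sup>2" unfolding v(2) by (simp add: power2_norm_eq_inner)
  then have "\<mu> * (norm v)\<^sup>2 = - (norm (A *v v))\<^sup>2" by (simp add: inner_gram)
  then have "\<mu> * (norm v)\<^sup>2 \<le> 0" by simp
  then have "\<mu> \<le> 0" using v(1) by (simp add: mult_le_0_iff)
  have "(transpose A ** A) *v v = (sqrt (- \<mu>))\<^sup>2 *\<^sub>R v"
    using v(2) \<open>\<mu> \<le> 0\<close> by (simp add: minus_equation_iff[of _ "\<mu> *\<^sub>R v"])
  then have "sqrt (- \<mu>) \<in> singular_values A"
    using v(1) \<open>\<mu> \<le> 0\<close> unfolding singular_values_def by auto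
  then have le: "sqrt (- \<mu>) \<le> sigma_max A"
    unfolding sigma_max_def using finite_singular_values by (rule Max_ge[rotated])
  have "norm (A *v x) \<le> sqrt (- \<mu>) * norm x"
  proof (rule power2_le_imp_le)
    show "(norm (A *v x))\<^sup>2 \<le> (sqrt (- \<mu>) * norm x)\<^sup>2"
      using bound[of x] \<open>\<mu> \<le> 0\<close> by (simp add: inner_gram power_mult_distrib)
  qed (use \<open>\<mu> \<le> 0\<close> in simp)
  also have "\<dots> \<le> sigma_max A * norm x"
    using le by (rule mult_right_mono) simp
  finally show ?thesis .
qed

text \<open>Restricting the Gram matrix to the row space excludes the kernel, so its least
  eigenvalue there is positive and its root is a nonzero singular value.\<close>

lemma sigma_min_properties:
  fixes A :: "real^'n^'m"
  assumes "A \<noteq> 0"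
  shows sigma_min_pos: "0 < sigma_min A"
    and sigma_min_le_norm_mult:
      "x \<in> span (rows A) \<Longrightarrow> (sigma_min A)\<^sup>2 * (norm x)\<^sup>2 \<le> (norm (A *v x))\<^sup>2"
proof -
  let ?f = "\<lambda>x. (transpose A ** A) *v x"
  have "\<exists>i. row i A \<noteq> 0" using assms by (auto simp: row_def vec_eq_iff)
  then have "span (rows A) \<noteq> {0}" by (force simp: rows_def intro: span_base)
  obtain v \<mu> where v: "v \<in> span (rows A)" "v \<noteq> 0" "?f v = \<mu> *\<^sub>R v"
    and bound: "\<And>x. x \<in> span (rows A) \<Longrightarrow> \<mu> * (norm x)\<^sup>2 \<le> x \<bullet> ?f x"
  proof (rule self_adjoint_least_eigenvalue[of ?f "span (rows A)"])
    show "?f x \<in> span (rows A)" for x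
      by (metis matrix_vector_mul_assoc transpose_mult_in_span_rows)
  qed (use \<open>span (rows A) \<noteq> {0}\<close> in \<open>auto simp: gram_self_adjoint\<close>)
  have "A *v v \<noteq> 0" using v nullspace_inter_rowspace by blast
  moreover have "v \<bullet> ?f v = \<mu> * (norm v)\<^sup>2" unfolding v(3) by (simp add: power2_norm_eq_inner)
  ultimately have "0 < \<mu> * (norm v)\<^sup>2" by (metis inner_gram zero_less_norm_iff zero_less_power)
  then have "\<mu> > 0" by (simp add: zero_less_mult_iff)
  then have "?f v = (sqrt \<mu>)\<^sup>2 *\<^sub>R v" using v(3) by simp
  then have mem: "sqrt \<mu> \<in> singular_values A - {0}"
    using v(2) \<open>\<mu> > 0\<close> unfolding singular_values_def by auto
  have fin: "finite (singular_values A - {0})" using finite_singular_values by blast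
  have le: "sigma_min A \<le> sqrt \<mu>"
    unfolding sigma_min_def using fin mem by (rule Min_le)
  have "sigma_min A \<in> singular_values A - {0}"
    unfolding sigma_min_def using fin mem by (intro Min_in) auto
  then show pos: "0 < sigma_min A" by (auto simp: singular_values_def)
  show "(sigma_min A)\<^sup>2 * (norm x)\<^sup>2 \<le> (norm (A *v x))\<^sup>2" if "x \<in> span (rows A)"
  proof -
    have "(sigma_min A)\<^sup>2 \<le> (sqrt \<mu>)\<^sup>2" using le pos by (intro power_mono) auto
    then have "(sigma_min A)\<^sup>2 * (norm x)\<^sup>2 \<le> \<mu> * (norm x)\<^sup>2"
      using \<open>\<mu> > 0\<close> by (intro mult_right_mono) auto
    then show ?thesis using bound[OF that] by (simp add: inner_gram)
  qed
qed

section \<open>One step of the method\<close>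

lemma row_row_submatrix [simp]: "row p (row_submatrix e A) = row (e p) A"
  by (simp add: row_submatrix_def row_def vec_eq_iff)

lemma row_submatrix_mult_nth [simp]: "(row_submatrix e A *v x) $ p = row (e p) A \<bullet> x"
  by (simp add: row_submatrix_def matrix_vector_mul_component)

lemma mult_nth_eq_row_inner: "((A::real^'n^'m) *v x) $ i = row i A \<bullet> x"
  by (simp add: matrix_vector_mul_component row_def)

lemma norm_power2_eq_sum: "(norm (y::real^'n))\<^sup>2 = (\<Sum>i\<in>UNIV. (y $ i)\<^sup>2)"
  by (simp add: norm_vec_def L2_set_def sum_nonneg)

lemma frobenius_norm_power2: "(frobenius_norm A)\<^sup>2 = (\<Sum>i\<in>UNIV. (norm (row i A))\<^sup>2)"
  by (simp add: frobenius_norm_eq_norm norm_vec_def[of A] L2_set_def sum_nonneg row_def)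

lemma frobenius_norm_row_submatrix_power2:
  fixes e :: "'k::finite \<Rightarrow> 'm::finite"
  assumes "bij_betw e UNIV J"
  shows "(frobenius_norm (row_submatrix e A))\<^sup>2 = (\<Sum>i\<in>J. (norm (row i A))\<^sup>2)"
  using sum.reindex_bij_betw[OF assms, of "\<lambda>i. (norm (row i A))\<^sup>2"]
  by (simp add: frobenius_norm_power2)

lemma norm_row_submatrix_mult_power2:
  fixes e :: "'k::finite \<Rightarrow> 'm::finite"
  assumes "bij_betw e UNIV J"
  shows "(norm (row_submatrix e A *v d))\<^sup>2 = (\<Sum>i\<in>J. (row i A \<bullet> d)\<^sup>2)"
  using sum.reindex_bij_betw[OF assms, of "\<lambda>i. (row i A \<bullet> d)\<^sup>2"]
  by (simp add: norm_power2_eq_sum)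

text \<open>The \<open>w\<close>-weighted mean of \<beta> over \<open>J\<close> is at least that
  over all indices, since the least selected value \<open>m\<close> separates \<open>J\<close> from
  its complement. The term with \<open>l - 1\<close> is nonnegative and only enlarges the right-hand
  side.\<close>

lemma sum_largest_ratio:
  fixes \<beta> w :: "'m::finite \<Rightarrow> real"
  assumes J: "indices_of_largest k \<beta> J" "J \<noteq> {}"
    and w: "\<And>i. 0 \<le> w i" and \<beta>: "\<And>i. 0 \<le> \<beta> i"
    and l: "1 \<le> l"
  shows "(\<Sum>i\<in>J. w i) * (\<Sum>i\<in>UNIV. \<beta> i * w i)
     \<le> ((\<Sum>i\<in>UNIV. w i) + (l - 1) * (\<Sum>i\<in>J. w i)) * (\<Sum>i\<in>J. \<beta> i * w i)"
proof -
  define m where "m = Min (\<beta> ` J)"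
  have "m \<in> \<beta> ` J" unfolding m_def using J(2) by (intro Min_in) auto
  then obtain j where j: "j \<in> J" "m = \<beta> j" by blast
  have lower: "m \<le> \<beta> i" if "i \<in> J" for i unfolding m_def using that by (intro Min_le) auto
  have upper: "\<beta> i \<le> m" if "i \<notin> J" for i
    using J(1) j that by (auto simp: indices_of_largest_def)
  define F s F' s' where "F = (\<Sum>i\<in>J. w i)" and "s = (\<Sum>i\<in>J. \<beta> i * w i)"
    and "F' = (\<Sum>i\<in>-J. w i)" and "s' = (\<Sum>i\<in>-J. \<beta> i * w i)"
  have nonneg: "0 \<le> F" "0 \<le> s" "0 \<le> F'"
    by (auto simp: F_def s_def F'_def w \<beta> intro!: sum_nonneg)
  have "m * F \<le> s" unfolding F_def s_def sum_distrib_left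
    by (intro sum_mono mult_right_mono lower w)
  then have "(m * F) * F' \<le> s * F'" using nonneg by (intro mult_right_mono)
  moreover have "s' \<le> m * F'" unfolding F'_def s'_def sum_distrib_left
    by (intro sum_mono mult_right_mono upper w) auto
  then have "F * s' \<le> F * (m * F')" using nonneg by (intro mult_left_mono)
  moreover have "0 \<le> (l - 1) * F * s" using nonneg l by simp
  moreover have "(\<Sum>i\<in>UNIV. g i) = (\<Sum>i\<in>J. g i) + (\<Sum>i\<in>-J. g i)" for g :: "'m \<Rightarrow> real"
    using sum.subset_diff[of J UNIV g] by (simp add: Compl_eq_Diff_UNIV)
  then have "(\<Sum>i\<in>UNIV. w i) = F + F'" "(\<Sum>i\<in>UNIV. \<beta> i * w i) = s + s'"
    by (simp_all add: F_def F'_def s_def s'_def)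
  ultimately show ?thesis
    unfolding F_def[symmetric] s_def[symmetric] by (simp add: algebra_simps)
qed

lemma indices_of_largest_power2:
  assumes "indices_of_largest k f J" "\<And>i. 0 \<le> f i"
  shows "indices_of_largest k (\<lambda>i. (f i)\<^sup>2) J"
  using assms by (simp add: indices_of_largest_def power_mono)

text \<open>Consistency turns the residual at \<open>x\<close> into the action of the row on the
  error. Multiplied out, the identity also covers a zero row.\<close>

lemma beta_power2_eq:
  assumes "A *v z = b"
  shows "(beta A b x i)\<^sup>2 * (norm (row i A))\<^sup>2 = (row i A \<bullet> (x - z))\<^sup>2"
proof (cases "row i A = 0")
  case False
  have "b $ i = row i A \<bullet> z" using assms mult_nth_eq_row_inner by metis
  with False show ?thesis
    by (simp add: beta_def power_divide inner_diff_right power2_commute)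
qed simp

lemma sum_beta_power2:
  assumes "A *v z = b"
  shows "(\<Sum>i\<in>UNIV. (beta A b x i)\<^sup>2 * (norm (row i A))\<^sup>2) = (norm (A *v (x - z)))\<^sup>2"
  by (simp add: beta_power2_eq[OF assms] norm_power2_eq_sum[of "A *v (x - z)"] mult_nth_eq_row_inner)

text \<open>The index attaining the minimum contributes the ratio 1; with a zero denominator it
  would contribute 0.\<close>

lemma lambda_ge_1:
  fixes J :: "'m::finite set"
  assumes "J \<noteq> {}" "lambda_min A b J x \<noteq> 0"
  shows "1 \<le> lambda A b J x"
proof -
  let ?f = "\<lambda>i. \<bar>b $ i - row i A \<bullet> x\<bar>\<^sup>2 / (norm (row i A))\<^sup>2"
  have "lambda_min A b J x \<in> ?f ` J"
    unfolding lambda_min_def using assms(1) by (intro Min_in) auto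
  then obtain i where i: "i \<in> J" "lambda_min A b J x = ?f i" by blast
  have "?f i / lambda_min A b J x \<le> lambda A b J x"
    unfolding lambda_def using i(1) by (intro Max_ge) auto
  then show ?thesis using i(2) assms(2) by simp
qed

text \<open>\<open>B\<close> takes the same value at \<open>d\<close> and at its projection, so the
  bound by \<open>sigma_max B\<close> can be applied to the projection.\<close>

lemma norm_pinv_projection_ge_sigma:
  "(norm (B *v d))\<^sup>2 / (sigma_max B)\<^sup>2 \<le> (norm (pinv B *v (B *v d)))\<^sup>2"
proof -
  have "(norm (B *v d))\<^sup>2 \<le> (sigma_max B * norm (pinv B *v (B *v d)))\<^sup>2"
    using norm_mult_le_sigma_max[of B "pinv B *v (B *v d)"]
    by (intro power_mono) (simp_all add: mult_pinv_mult)
  then show ?thesis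
    \<comment> \<open>For \<open>sigma_max B = 0\<close> the quotient is 0 by the convention on
      division.\<close>
    by (cases "sigma_max B = 0") (simp_all add: power_mult_distrib field_simps)
qed

lemma norm_pinv_projection_ge_row:
  "\<bar>row p B \<bullet> d\<bar> \<le> norm (row p B) * norm (pinv B *v (B *v d))"
proof -
  have "row p B \<bullet> d = row p B \<bullet> (pinv B *v (B *v d))"
    by (metis mult_pinv_mult mult_nth_eq_row_inner)
  then show ?thesis by (metis Cauchy_Schwarz_ineq2)
qed

lemma norm_projection_ge_varsigma:
  fixes A :: "real^'n^'m" and e :: "'k::finite \<Rightarrow> 'm"
  assumes rows_nonzero: "\<And>i. row i A \<noteq> 0"
    and z: "A *v z = b" "x - z \<in> span (rows A)"
    and J: "indices_of_largest k (beta A b x) J" "bij_betw e UNIV J"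
    and lam: "lambda_min A b J x \<noteq> 0"
  shows "varsigma A b J e x * (norm (x - z))\<^sup>2
     \<le> (norm (pinv (row_submatrix e A) *v (row_submatrix e A *v (x - z))))\<^sup>2"
proof -
  let ?B = "row_submatrix e A" and ?d = "x - z"
  define F FJ l where "F = (frobenius_norm A)\<^sup>2" and "FJ = (frobenius_norm ?B)\<^sup>2"
    and "l = lambda A b J x"
  have "J \<noteq> {}" using J(2) by (auto simp: bij_betw_def)
  then have l: "1 \<le> l" unfolding l_def using lam by (rule lambda_ge_1)
  have "0 < F"
    unfolding F_def frobenius_norm_power2 by (intro sum_pos) (auto simp: rows_nonzero)
  have "0 \<le> FJ" by (simp add: FJ_def)
  then have D: "0 < F + (l - 1) * FJ" using \<open>0 < F\<close> l by (simp add: add_pos_nonneg)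
  have "A \<noteq> 0" using rows_nonzero by (auto simp: row_def zero_vec_def)
  then have "(sigma_min A)\<^sup>2 * (norm ?d)\<^sup>2 \<le> (norm (A *v ?d))\<^sup>2"
    using z(2) by (rule sigma_min_le_norm_mult)
  then have "FJ * ((sigma_min A)\<^sup>2 * (norm ?d)\<^sup>2) \<le> FJ * (norm (A *v ?d))\<^sup>2"
    using \<open>0 \<le> FJ\<close> by (rule mult_left_mono)
  also have "\<dots> \<le> (F + (l - 1) * FJ) * (norm (?B *v ?d))\<^sup>2"
  proof -
    have "indices_of_largest k (\<lambda>i. (beta A b x i)\<^sup>2) J"
      using J(1) by (rule indices_of_largest_power2) (simp add: beta_def)
    \<comment> \<open>With squared row norms as weights, the weighted sums of the squared
      \<open>beta\<close> values become the squared norms of \<open>A *v ?d\<close> and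
      \<open>?B *v ?d\<close>.\<close>
    from sum_largest_ratio[OF this \<open>J \<noteq> {}\<close> _ _ l, of "\<lambda>i. (norm (row i A))\<^sup>2"]
    show ?thesis
      by (simp add: F_def FJ_def frobenius_norm_power2[of A] sum_beta_power2[OF z(1)]
          frobenius_norm_row_submatrix_power2[OF J(2)] norm_row_submatrix_mult_power2[OF J(2)]
          beta_power2_eq[OF z(1)] norm_power2_eq_sum[of "A *v (x - z)"] mult_nth_eq_row_inner)
  qed
  finally have "FJ / (F + (l - 1) * FJ) * ((sigma_min A)\<^sup>2 * (norm ?d)\<^sup>2) \<le> (norm (?B *v ?d))\<^sup>2"
    using D by (simp add: pos_divide_le_eq mult.commute)
  then have "FJ / (F + (l - 1) * FJ) * ((sigma_min A)\<^sup>2 * (norm ?d)\<^sup>2) / (sigma_max ?B)\<^sup>2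
      \<le> (norm (?B *v ?d))\<^sup>2 / (sigma_max ?B)\<^sup>2"
    by (rule divide_right_mono) simp
  also have "\<dots> \<le> (norm (pinv ?B *v (?B *v ?d)))\<^sup>2"
    by (rule norm_pinv_projection_ge_sigma)
  finally show ?thesis
    by (simp add: varsigma_def Let_def F_def FJ_def l_def)
qed

text \<open>\<open>P\<close> bounds \<open>beta\<close> on \<open>J\<close>, hence everywhere,
  because \<open>J\<close> holds the largest values. The bound also applies at steps where
  \<open>lambda\<close> is undefined.\<close>

lemma norm_projection_ge_uniform:
  fixes A :: "real^'n^'m" and e :: "'k::finite \<Rightarrow> 'm"
  assumes rows_nonzero: "\<And>i. row i A \<noteq> 0"
    and z: "A *v z = b" "x - z \<in> span (rows A)"
    and J: "indices_of_largest k (beta A b x) J" "bij_betw e UNIV J"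
  shows "(sigma_min A)\<^sup>2 / (frobenius_norm A)\<^sup>2 * (norm (x - z))\<^sup>2
     \<le> (norm (pinv (row_submatrix e A) *v (row_submatrix e A *v (x - z))))\<^sup>2"
proof -
  let ?B = "row_submatrix e A" and ?d = "x - z"
  define P where "P = norm (pinv ?B *v (?B *v ?d))"
  have in_J: "beta A b x i \<le> P" if "i \<in> J" for i
  proof -
    obtain p where p: "i = e p" using J(2) \<open>i \<in> J\<close> by (auto simp: bij_betw_def)
    have "b $ i = row i A \<bullet> z" using z(1) mult_nth_eq_row_inner by metis
    then have "\<bar>b $ i - row i A \<bullet> x\<bar> \<le> norm (row i A) * P"
      using norm_pinv_projection_ge_row[of p ?B ?d]
      by (simp add: p P_def inner_diff_right abs_minus_commute)
    then show ?thesis using rows_nonzero by (simp add: beta_def divide_le_eq mult.commute)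
  qed
  obtain j where j: "j \<in> J" using J(2) by (auto simp: bij_betw_def)
  have le_P: "beta A b x i \<le> P" for i
    using in_J j J(1) by (cases "i \<in> J") (auto simp: indices_of_largest_def intro: order_trans)
  have "(norm (A *v ?d))\<^sup>2 \<le> (\<Sum>i\<in>UNIV. P\<^sup>2 * (norm (row i A))\<^sup>2)"
    unfolding sum_beta_power2[OF z(1), symmetric]
    by (intro sum_mono mult_right_mono power_mono le_P) (auto simp: beta_def)
  also have "\<dots> = P\<^sup>2 * (frobenius_norm A)\<^sup>2"
    by (simp add: frobenius_norm_power2 sum_distrib_left)
  finally have le: "(norm (A *v ?d))\<^sup>2 \<le> P\<^sup>2 * (frobenius_norm A)\<^sup>2" .
  have "0 < (frobenius_norm A)\<^sup>2"
    unfolding frobenius_norm_power2 by (intro sum_pos) (auto simp: rows_nonzero)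
  moreover have "A \<noteq> 0" using rows_nonzero by (auto simp: row_def zero_vec_def)
  then have "(sigma_min A)\<^sup>2 * (norm ?d)\<^sup>2 \<le> (norm (A *v ?d))\<^sup>2"
    using z(2) by (rule sigma_min_le_norm_mult)
  ultimately show ?thesis
    using le by (simp add: P_def[symmetric] pos_divide_le_eq)
qed

section \<open>Convergence from a uniform contraction factor\<close>

lemma contraction_tendsto:
  fixes x :: "nat \<Rightarrow> 'a::real_normed_vector"
  assumes "0 < c" and step: "\<And>t. (norm (x (Suc t) - z))\<^sup>2 \<le> (1 - c) * (norm (x t - z))\<^sup>2"
  shows "x \<longlonglongrightarrow> z"
proof -
  \<comment> \<open>\<open>c\<close> may exceed 1; the maximum keeps the ratio of the geometric
    bound nonnegative.\<close>
  define q where "q = max 0 (1 - c)"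
  have q: "0 \<le> q" "q < 1" using \<open>0 < c\<close> by (auto simp: q_def)
  have bound: "(norm (x t - z))\<^sup>2 \<le> q ^ t * (norm (x 0 - z))\<^sup>2" for t
  proof (induction t)
    case (Suc t)
    have "(norm (x (Suc t) - z))\<^sup>2 \<le> q * (norm (x t - z))\<^sup>2"
      using step[of t] by (rule order_trans) (simp add: q_def mult_right_mono)
    also have "\<dots> \<le> q * (q ^ t * (norm (x 0 - z))\<^sup>2)"
      using Suc q(1) by (rule mult_left_mono)
    finally show ?case by (simp add: mult.assoc)
  qed simp
  have "(\<lambda>t. q ^ t * (norm (x 0 - z))\<^sup>2) \<longlonglongrightarrow> 0"
    using q by (intro tendsto_mult_left_zero LIMSEQ_realpow_zero)
  then have "(\<lambda>t. (norm (x t - z))\<^sup>2) \<longlonglongrightarrow> 0"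
    by (rule tendsto_sandwich[rotated 3]) (auto simp: bound)
  then have "(\<lambda>t. norm (x t - z)) \<longlonglongrightarrow> 0"
    using tendsto_real_sqrt[of "\<lambda>t. (norm (x t - z))\<^sup>2" 0 sequentially] by simp
  then show ?thesis
    using LIM_zero_cancel tendsto_norm_zero_iff by blast
qed

text \<open>Every correction lies in the row space, so a kernel component of \<open>x0\<close> would
  survive unchanged; \<open>x0 \<in> span (rows A)\<close> makes it zero, as the limit
  \<open>pinv A *v b\<close> requires.\<close>

theorem theorem3p1:
  fixes A :: "real^'n^'m"
    and b :: "real^'m"
    and kmax :: nat
    and J :: "nat \<Rightarrow> 'm set"
    and e :: "nat \<Rightarrow> 'k::finite \<Rightarrow> 'm"
    and x0 :: "real^'n"
    and x :: "nat \<Rightarrow> real^'n"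
    and xstar :: "real^'n"
  assumes rows_nonzero: "\<And>i. row i A \<noteq> 0"
    and consistent: "\<exists>z. A *v z = b"
    and kmax: "1 \<le> kmax" "kmax \<le> CARD('m)" "CARD('k) = kmax"
    and initial: "x 0 = x0" "x0 \<in> span (rows A)"
    and run: "block_kaczmarz_run A b kmax J e x"
    and xstar: "xstar = pinv A *v b"
  shows "x \<longlonglongrightarrow> xstar \<and>
    (\<forall>t. lambda_min A b (J t) (x t) \<noteq> 0 \<longrightarrow>
       lambda A b (J t) (x t) \<ge> 1 \<and>
       (norm (x (Suc t) - xstar))\<^sup>2
         \<le> (1 - varsigma A b (J t) (e t) (x t)) * (norm (x t - xstar))\<^sup>2)"
proof -
  have J: "indices_of_largest kmax (beta A b (x t)) (J t)" "bij_betw (e t) UNIV (J t)"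
    and step: "x (Suc t) = x t + pinv (row_submatrix (e t) A) *v
        (subvector (e t) b - row_submatrix (e t) A *v x t)" for t
    using run by (auto simp: block_kaczmarz_run_def)
  have Axstar: "A *v xstar = b" using consistent xstar mult_pinv_mult by metis
  define P where
    "P t = pinv (row_submatrix (e t) A) *v (row_submatrix (e t) A *v (x t - xstar))" for t
  \<comment> \<open>By consistency the block residual is the block applied to
    \<open>xstar - x t\<close>, so the step subtracts from the error its projection
    \<open>P t\<close>.\<close>
  have "subvector (e t) b = row_submatrix (e t) A *v xstar" for t
    by (simp add: vec_eq_iff subvector_def mult_nth_eq_row_inner flip: Axstar)
  then have error: "x (Suc t) - xstar = (x t - xstar) - P t" for t
    by (simp add: step P_def matrix_vector_mult_diff_distrib)
  have norm_error: "(norm (x (Suc t) - xstar))\<^sup>2 = (norm (x t - xstar))\<^sup>2 - (norm (P t))\<^sup>2" for t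
    unfolding error P_def by (rule norm_diff_pinv_projection)
  have "rows (row_submatrix (e t) A) \<subseteq> rows A" for t
    by (auto simp: rows_def)
  then have P_span: "P t \<in> span (rows A)" for t
    unfolding P_def using pinv_in_span_rows span_mono by blast
  have in_span: "x t - xstar \<in> span (rows A)" for t
  proof (induction t)
    case 0
    then show ?case using initial by (simp add: xstar pinv_in_span_rows span_diff)
  next
    case (Suc t)
    then show ?case unfolding error using P_span by (rule span_diff)
  qed
  have "x \<longlonglongrightarrow> xstar"
  proof (rule contraction_tendsto)
    have "A \<noteq> 0" using rows_nonzero by (auto simp: row_def zero_vec_def)
    then show "0 < (sigma_min A)\<^sup>2 / (frobenius_norm A)\<^sup>2"
      using sigma_min_pos[of A] by (simp add: frobenius_norm_eq_norm)
    show "(norm (x (Suc t) - xstar))\<^sup>2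
        \<le> (1 - (sigma_min A)\<^sup>2 / (frobenius_norm A)\<^sup>2) * (norm (x t - xstar))\<^sup>2" for t
      using norm_projection_ge_uniform[OF rows_nonzero Axstar in_span J]
      unfolding norm_error P_def by (simp add: left_diff_distrib)
  qed
  moreover have "1 \<le> lambda A b (J t) (x t)" if "lambda_min A b (J t) (x t) \<noteq> 0" for t
    using J(2)[of t] that by (intro lambda_ge_1) (auto simp: bij_betw_def)
  moreover have "(norm (x (Suc t) - xstar))\<^sup>2
      \<le> (1 - varsigma A b (J t) (e t) (x t)) * (norm (x t - xstar))\<^sup>2"
    if "lambda_min A b (J t) (x t) \<noteq> 0" for t
    using norm_projection_ge_varsigma[OF rows_nonzero Axstar in_span J that]
    unfolding norm_error P_def by (simp add: left_diff_distrib)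
  ultimately show ?thesis by blast
qed

end
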